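(* Let $X$ be a finite metric space, and let $G$ be a minimal spanning tree on $X$. For any distinct $v,w\in X$, let $\gamma_{vw}$ denote the unique path in $G$ connecting $v$ and $w$, and let $E(\gamma_{vw})$ denote its set of edges. Then $X$ is ultrametric if and only if for any distinct points $v,w\in X$ the equality $$ |vw|=\max_{e\in E(\gamma_{vw})}|e| $$ holds.
   Context: $|xy|$ denotes the distance between points $x,y$ of a metric space. A metric space $X$ is ultrametric if $|xz|\le\max\{|xy|,|yz|\}$ for all $x,y,z\in X$. For a finite metric space $X$ and a tree $G=(X,E)$ with vertex set $X$, the length of an edge $e=vw$ is $|e|=|vw|$ and the length of $G$ is the sum of the lengths of its edges. A minimal spanning tree on $X$ is a tree with vertex set $X$ of least possible length among all trees with vertex set $X$. *)

theory Defs
  imports "HOL-Analysis.Abstract_Metric_Spaces"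
begin

definition ultrametric_on :: "'a set \<Rightarrow> ('a \<Rightarrow> 'a \<Rightarrow> real) \<Rightarrow> bool" where
  "ultrametric_on X d \<longleftrightarrow> (\<forall>x\<in>X. \<forall>y\<in>X. \<forall>z\<in>X. d x z \<le> max (d x y) (d y z))"

text \<open>
  A simple graph is given by its vertex set \<open>X\<close> and a set \<open>E\<close> of two-element subsets of \<open>X\<close>.
\<close>

definition simple_graph :: "'a set \<Rightarrow> 'a set set \<Rightarrow> bool" where
  "simple_graph X E \<longleftrightarrow> (\<forall>e\<in>E. \<exists>v\<in>X. \<exists>w\<in>X. v \<noteq> w \<and> e = {v, w})"

text \<open>
  Paths are represented by the list of their vertices; the one-element list is the trivial path.
\<close>

definition graph_path :: "'a set \<Rightarrow> 'a set set \<Rightarrow> 'a \<Rightarrow> 'a list \<Rightarrow> 'a \<Rightarrow> bool" where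
  "graph_path X E v p w \<longleftrightarrow>
     p \<noteq> [] \<and> hd p = v \<and> last p = w \<and> set p \<subseteq> X \<and> distinct p \<and>
     successively (\<lambda>a b. {a, b} \<in> E) p"

definition path_edges :: "'a list \<Rightarrow> 'a set set" where
  "path_edges p = {{p ! i, p ! Suc i} | i. Suc i < length p}"

definition graph_connected :: "'a set \<Rightarrow> 'a set set \<Rightarrow> bool" where
  "graph_connected X E \<longleftrightarrow> (\<forall>v\<in>X. \<forall>w\<in>X. \<exists>p. graph_path X E v p w)"

text \<open>
  A cycle is a path on at least three vertices whose end points are joined by an edge.
\<close>

definition graph_acyclic :: "'a set \<Rightarrow> 'a set set \<Rightarrow> bool" where
  "graph_acyclic X E \<longleftrightarrow>
     \<not> (\<exists>v p w. graph_path X E v p w \<and> 3 \<le> length p \<and> {w, v} \<in> E)"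

definition tree_on :: "'a set \<Rightarrow> 'a set set \<Rightarrow> bool" where
  "tree_on X E \<longleftrightarrow> simple_graph X E \<and> graph_connected X E \<and> graph_acyclic X E"

text \<open>
  The description determines the path only when there is exactly one, as between any two
  vertices of a tree.
\<close>

definition tree_path :: "'a set \<Rightarrow> 'a set set \<Rightarrow> 'a \<Rightarrow> 'a \<Rightarrow> 'a list" where
  "tree_path X E v w = (THE p. graph_path X E v p w)"

definition edge_length :: "('a \<Rightarrow> 'a \<Rightarrow> real) \<Rightarrow> 'a set \<Rightarrow> real" where
  "edge_length d e = (THE r. \<exists>v w. e = {v, w} \<and> r = d v w)"

text \<open>Edges are unordered, so that \<^const>\<open>edge_length\<close> relies on the symmetry of the distance.\<close>

lemma (in Metric_space) edge_length_eq: "edge_length d {v, w} = d v w"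
  unfolding edge_length_def by (rule the_equality) (auto simp: doubleton_eq_iff commute)

definition graph_length :: "('a \<Rightarrow> 'a \<Rightarrow> real) \<Rightarrow> 'a set set \<Rightarrow> real" where
  "graph_length d E = (\<Sum>e\<in>E. edge_length d e)"

definition minimal_spanning_tree :: "'a set \<Rightarrow> ('a \<Rightarrow> 'a \<Rightarrow> real) \<Rightarrow> 'a set set \<Rightarrow> bool" where
  "minimal_spanning_tree X d E \<longleftrightarrow>
     tree_on X E \<and> (\<forall>E'. tree_on X E' \<longrightarrow> graph_length d E \<le> graph_length d E')"

end

theory Submission
  imports Defs
begin

text \<open>
  Everything rests on two opposite facts about reachability. In an acyclic graph every edge is a
  bridge: deleting it separates its end points (\<open>acyclic_edge_is_bridge\<close>). In any graph, an edge of
  a cycle can be deleted without losing connectedness (\<open>connected_delete_cycle_edge\<close>).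

  Suppose the length formula holds. If an edge of the tree path from \<open>x\<close> to \<open>z\<close> occurred neither on
  the path from \<open>x\<close> to \<open>y\<close> nor on the one from \<open>y\<close> to \<open>z\<close>, then its end points could be joined
  through \<open>y\<close> while avoiding it, and it would not be a bridge. So every edge of the path from \<open>x\<close>
  to \<open>z\<close> is an edge of one of the other two paths, and comparing maxima gives the ultrametric
  inequality (\<open>acyclic_path_edges_triangle\<close>).

  Conversely, suppose the space is ultrametric. The inequality iterated along a path bounds
  \<open>d v w\<close> by the longest edge of the path. For the opposite bound let \<open>e\<close> be an edge of the path
  from \<open>v\<close> to \<open>w\<close> other than \<open>{v, w}\<close>. The edge \<open>{v, w}\<close> closes the path to a cycle through \<open>e\<close>, so after
  exchanging \<open>e\<close> for \<open>{v, w}\<close> the graph is still connected. By minimality of the tree it is not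
  shorter than the tree, which says that \<open>e\<close> is not longer than \<open>d v w\<close>. This bound holds in
  every finite metric space. That the exchanged graph is again a tree need not be shown: it
  contains a spanning tree, which is no longer than the graph itself.
\<close>

section \<open>Walks and reachability\<close>

definition adjacent :: "'a set set \<Rightarrow> ('a \<times> 'a) set" where
  "adjacent E = {(a, b). {a, b} \<in> E}"

lemma reachable_sym: "(a, b) \<in> (adjacent E)\<^sup>* \<Longrightarrow> (b, a) \<in> (adjacent E)\<^sup>*"
proof -
  have "sym (adjacent E)"
    by (auto simp: sym_def adjacent_def insert_commute)
  then show "(a, b) \<in> (adjacent E)\<^sup>* \<Longrightarrow> (b, a) \<in> (adjacent E)\<^sup>*"
    by (meson sym_rtrancl symD)
qed

lemma walk_reachable:
  "successively (\<lambda>a b. {a, b} \<in> E) p \<Longrightarrow> p \<noteq> [] \<Longrightarrow> (hd p, last p) \<in> (adjacent E)\<^sup>*"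
proof (induction p rule: induct_list012)
  case (3 x y zs)
  then have "(x, y) \<in> adjacent E" "(y, last (y # zs)) \<in> (adjacent E)\<^sup>*"
    by (auto simp: adjacent_def)
  then show ?case
    by (simp add: converse_rtrancl_into_rtrancl)
qed auto

lemma walk_avoiding_vertex:
  assumes "successively (\<lambda>a b. {a, b} \<in> E) p" "c \<notin> set p" "c \<in> e"
  shows "successively (\<lambda>a b. {a, b} \<in> E - {e}) p"
  using assms(1) by (rule successively_mono) (use assms in auto)

lemma walk_avoiding_edge:
  assumes "successively (\<lambda>a b. {a, b} \<in> E) p" "e \<notin> path_edges p"
  shows "successively (\<lambda>a b. {a, b} \<in> E - {e}) p"
  using assms by (auto simp: successively_conv_nth path_edges_def)

lemma in_path_edges_iff:
  "e \<in> path_edges p \<longleftrightarrow> (\<exists>xs a b ys. p = xs @ a # b # ys \<and> e = {a, b})"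
proof
  assume "e \<in> path_edges p"
  then obtain i where i: "Suc i < length p" "e = {p ! i, p ! Suc i}"
    by (auto simp: path_edges_def)
  then have "p = take i p @ p ! i # p ! Suc i # drop (Suc (Suc i)) p"
    by (metis Cons_nth_drop_Suc Suc_lessD append_take_drop_id)
  with i show "\<exists>xs a b ys. p = xs @ a # b # ys \<and> e = {a, b}"
    by blast
next
  assume "\<exists>xs a b ys. p = xs @ a # b # ys \<and> e = {a, b}"
  then obtain xs a b ys where *: "p = xs @ a # b # ys" "e = {a, b}"
    by blast
  then have "Suc (length xs) < length p" "e = {p ! length xs, p ! Suc (length xs)}"
    by (auto simp: nth_append)
  then show "e \<in> path_edges p"
    unfolding path_edges_def by blast
qed

lemma finite_path_edges: "finite (path_edges p)"
proof -
  have "path_edges p \<subseteq> (\<lambda>i. {p ! i, p ! Suc i}) ` {..<length p}"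
    by (auto simp: path_edges_def)
  then show ?thesis
    using finite_surj by blast
qed

lemma path_edges_Cons_Cons: "path_edges (x # y # p) = insert {x, y} (path_edges (y # p))"
proof (intro set_eqI)
  fix e
  have "(\<exists>i. Suc i < length (x # y # p) \<and> e = {(x # y # p) ! i, (x # y # p) ! Suc i}) \<longleftrightarrow>
    e = {x, y} \<or> (\<exists>i. Suc i < length (y # p) \<and> e = {(y # p) ! i, (y # p) ! Suc i})"
    by (simp add: Ex_less_Suc2)
  then show "e \<in> path_edges (x # y # p) \<longleftrightarrow> e \<in> insert {x, y} (path_edges (y # p))"
    by (auto simp: path_edges_def)
qed

lemma path_edges_subset:
  assumes "graph_path X E v p w"
  shows "path_edges p \<subseteq> E"
  using assms by (auto simp: graph_path_def path_edges_def successively_conv_nth)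

lemma path_edges_nonempty:
  assumes "graph_path X E v p w" "v \<noteq> w"
  shows "path_edges p \<noteq> {}"
proof -
  from assms obtain x y q where "p = x # y # q"
    unfolding graph_path_def by (metis last_ConsL list.exhaust_sel)
  then show ?thesis
    by (simp add: path_edges_Cons_Cons)
qed

lemma graph_path_mono: "graph_path X E v p w \<Longrightarrow> E \<subseteq> F \<Longrightarrow> graph_path X F v p w"
  unfolding graph_path_def by (auto elim: successively_mono)

lemma graph_path_reachable: "graph_path X E v p w \<Longrightarrow> (v, w) \<in> (adjacent E)\<^sup>*"
  unfolding graph_path_def using walk_reachable by blast

lemma path_reachable_avoiding_vertex:
  assumes "graph_path X E v p w" "c \<notin> set p" "c \<in> e"
  shows "(v, w) \<in> (adjacent (E - {e}))\<^sup>*"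
  using assms walk_reachable[OF walk_avoiding_vertex, of E p c e] by (auto simp: graph_path_def)

lemma path_reachable_avoiding_edge:
  assumes "graph_path X E v p w" "e \<notin> path_edges p"
  shows "(v, w) \<in> (adjacent (E - {e}))\<^sup>*"
  using assms walk_reachable[OF walk_avoiding_edge, of E p e] by (auto simp: graph_path_def)

text \<open>
  A path has no repeated vertices, so the part before one of its edges misses the far end point of
  that edge and the part after it misses the near one. Neither part uses the edge.
\<close>

lemma path_edge_split:
  assumes "graph_path X E v p w" "e \<in> path_edges p"
  obtains a b where "e = {a, b}" "(v, a) \<in> (adjacent (E - {e}))\<^sup>*" "(b, w) \<in> (adjacent (E - {e}))\<^sup>*"
proof -
  from assms(2) obtain xs a b ys where p: "p = xs @ a # b # ys" and e: "e = {a, b}"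
    by (auto simp: in_path_edges_iff)
  have gp: "successively (\<lambda>a b. {a, b} \<in> E) ((xs @ [a]) @ (b # ys))" "distinct p"
    "hd p = v" "last p = w"
    using assms(1) p by (auto simp: graph_path_def)
  then have s: "successively (\<lambda>a b. {a, b} \<in> E) (xs @ [a])" "successively (\<lambda>a b. {a, b} \<in> E) (b # ys)"
    unfolding successively_append_iff[of _ "xs @ [a]"] by auto
  have "b \<notin> set (xs @ [a])" "a \<notin> set (b # ys)"
    using gp(2) p by auto
  then have "(hd (xs @ [a]), last (xs @ [a])) \<in> (adjacent (E - {e}))\<^sup>*"
    "(hd (b # ys), last (b # ys)) \<in> (adjacent (E - {e}))\<^sup>*"
    using walk_reachable walk_avoiding_vertex[OF s(1), of b e] walk_avoiding_vertex[OF s(2), of a e] e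
    by blast+
  moreover have "hd (xs @ [a]) = v" "last (b # ys) = w"
    using gp(3,4) p by (auto simp: hd_append)
  ultimately show thesis
    using that[of a b] e by simp
qed

lemma reachable_imp_path:
  assumes "simple_graph X E" "(v, w) \<in> (adjacent E)\<^sup>*" "w \<in> X"
  shows "\<exists>p. graph_path X E v p w"
  using assms(2)
proof (induction rule: converse_rtrancl_induct)
  case base
  have "graph_path X E w [w] w"
    using assms(3) by (simp add: graph_path_def)
  then show ?case ..
next
  case (step v u)
  then obtain p where p: "graph_path X E u p w"
    by blast
  have vu: "{v, u} \<in> E" "v \<in> X"
    using step.hyps(1) assms(1) by (auto simp: adjacent_def simple_graph_def doubleton_eq_iff)
  show ?case
  proof (cases "v \<in> set p")
    \<comment> \<open>Prepending \<open>v\<close> would repeat it, so the loop at \<open>v\<close> is cut out.\<close>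
    case True
    then obtain xs ys where "p = xs @ v # ys"
      by (meson split_list)
    then have "graph_path X E v (v # ys) w"
      using p by (auto simp: graph_path_def successively_append_iff)
    then show ?thesis ..
  next
    case False
    then have "graph_path X E v (v # p) w"
      using p vu by (auto simp: graph_path_def successively_Cons)
    then show ?thesis ..
  qed
qed

lemma graph_connected_iff_reachable:
  assumes "simple_graph X E"
  shows "graph_connected X E \<longleftrightarrow> (\<forall>v\<in>X. \<forall>w\<in>X. (v, w) \<in> (adjacent E)\<^sup>*)"
  unfolding graph_connected_def
  using reachable_imp_path[OF assms] graph_path_reachable by metis

section \<open>Bridges and paths in acyclic graphs\<close>

text \<open>
  A path between the end points of an edge that avoids this edge has at least three vertices, so
  together with the edge it forms a cycle.
\<close>

lemma acyclic_edge_is_bridge: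
  assumes "simple_graph X E" "graph_acyclic X E" "{a, b} \<in> E"
  shows "(a, b) \<notin> (adjacent (E - {{a, b}}))\<^sup>*"
proof
  assume *: "(a, b) \<in> (adjacent (E - {{a, b}}))\<^sup>*"
  have ab: "a \<noteq> b" "b \<in> X"
    using assms(1,3) by (auto simp: simple_graph_def doubleton_eq_iff)
  have "simple_graph X (E - {{a, b}})"
    using assms(1) by (auto simp: simple_graph_def)
  then obtain p where p: "graph_path X (E - {{a, b}}) a p b"
    using reachable_imp_path * ab(2) by metis
  have "3 \<le> length p"
  proof (rule ccontr)
    assume "\<not> 3 \<le> length p"
    then have "length p = 0 \<or> length p = Suc 0 \<or> length p = Suc (Suc 0)"
      by linarith
    then show False
      using p ab(1) by (auto simp: graph_path_def length_Suc_conv)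
  qed
  moreover have "graph_path X E a p b"
    using p by (rule graph_path_mono) auto
  moreover have "{b, a} \<in> E"
    using assms(3) by (simp add: insert_commute)
  ultimately show False
    using assms(2) unfolding graph_acyclic_def by blast
qed

text \<open>
  Two paths with the same ends that leave their common start \<open>v\<close> along different edges would
  connect the end points of the first of these edges around the edge itself.
\<close>

lemma acyclic_path_unique:
  assumes "simple_graph X E" "graph_acyclic X E" "graph_path X E v p w" "graph_path X E v q w"
  shows "p = q"
  using assms(3,4)
proof (induction p arbitrary: v q)
  case Nil
  then show ?case by (simp add: graph_path_def)
next
  case (Cons x p)
  from Cons.prems have x: "x = v"
    by (simp add: graph_path_def)
  from Cons.prems(2) obtain q' where q: "q = v # q'"
    unfolding graph_path_def by (metis list.collapse)
  show ?case
  proof (cases "p = [] \<or> q' = []")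
    case True
    then have "v = w"
      using Cons.prems x q by (auto simp: graph_path_def)
    then have "p = []" "q' = []"
      using Cons.prems x q by (auto simp: graph_path_def split: if_splits)
    then show ?thesis
      using x q by simp
  next
    case False
    then have tails: "graph_path X E (hd p) p w" "graph_path X E (hd q') q' w"
      and e: "{v, hd p} \<in> E" and v: "v \<notin> set p" "v \<notin> set q'"
      and vq: "{v, hd q'} \<in> E"
      using Cons.prems x q by (auto simp: graph_path_def successively_Cons)
    have "hd p = hd q'"
    proof (rule ccontr)
      assume neq: "hd p \<noteq> hd q'"
      let ?R = "(adjacent (E - {{v, hd p}}))\<^sup>*"
      have "(hd p, w) \<in> ?R" "(hd q', w) \<in> ?R"
        using tails v by (auto intro: path_reachable_avoiding_vertex)
      moreover have "(v, hd q') \<in> ?R"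
        using neq vq by (auto simp: adjacent_def doubleton_eq_iff)
      ultimately have "(v, hd p) \<in> ?R"
        by (meson reachable_sym rtrancl_trans)
      then show False
        using acyclic_edge_is_bridge[OF assms(1,2) e] by blast
    qed
    then have "p = q'"
      using Cons.IH[OF tails(1)] tails(2) by simp
    then show ?thesis
      using x q by simp
  qed
qed

lemma tree_path_is_path:
  assumes "tree_on X E" "v \<in> X" "w \<in> X"
  shows "graph_path X E v (tree_path X E v w) w"
proof -
  have "\<exists>!p. graph_path X E v p w"
    using assms acyclic_path_unique[of X E] unfolding tree_on_def graph_connected_def by metis
  then show ?thesis
    unfolding tree_path_def by (rule theI')
qed

text \<open>
  An edge on \<open>p\<close> but on neither \<open>q\<close> nor \<open>r\<close> would not be a bridge: from its end point
  nearer to \<open>x\<close> one can follow \<open>p\<close> back to \<open>x\<close>, then \<open>q\<close> and \<open>r\<close> to \<open>z\<close>, and from there \<open>p\<close> back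
  to the other end point.
\<close>

lemma acyclic_path_edges_triangle:
  assumes "simple_graph X E" "graph_acyclic X E"
    and "graph_path X E x p z" "graph_path X E x q y" "graph_path X E y r z"
  shows "path_edges p \<subseteq> path_edges q \<union> path_edges r"
proof
  fix e assume e: "e \<in> path_edges p"
  show "e \<in> path_edges q \<union> path_edges r"
  proof (rule ccontr)
    assume "e \<notin> path_edges q \<union> path_edges r"
    then have xyz: "(x, y) \<in> (adjacent (E - {e}))\<^sup>*" "(y, z) \<in> (adjacent (E - {e}))\<^sup>*"
      using path_reachable_avoiding_edge[OF assms(4)] path_reachable_avoiding_edge[OF assms(5)] by auto
    obtain a b where ab: "e = {a, b}" "(x, a) \<in> (adjacent (E - {e}))\<^sup>*"
      "(b, z) \<in> (adjacent (E - {e}))\<^sup>*"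
      using path_edge_split[OF assms(3) e] by blast
    have "(a, b) \<in> (adjacent (E - {e}))\<^sup>*"
      using xyz ab(2,3) by (meson reachable_sym rtrancl_trans)
    moreover have "{a, b} \<in> E"
      using path_edges_subset[OF assms(3)] e ab(1) by blast
    ultimately show False
      using acyclic_edge_is_bridge[OF assms(1,2)] ab(1) by blast
  qed
qed

section \<open>Deleting edges of cycles\<close>

lemma connected_delete_edge:
  assumes "simple_graph X E" "graph_connected X E" "(a, b) \<in> (adjacent (E - {{a, b}}))\<^sup>*"
  shows "graph_connected X (E - {{a, b}})"
proof -
  let ?F = "E - {{a, b}}"
  have "adjacent E \<subseteq> (adjacent ?F)\<^sup>*"
  proof (rule subrelI)
    fix u t assume ut: "(u, t) \<in> adjacent E"
    show "(u, t) \<in> (adjacent ?F)\<^sup>*"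
    proof (cases "{u, t} = {a, b}")
      case True
      then show ?thesis
        using assms(3) reachable_sym by (auto simp: doubleton_eq_iff)
    next
      case False
      then show ?thesis
        using ut by (auto simp: adjacent_def)
    qed
  qed
  then have "(adjacent E)\<^sup>* \<subseteq> (adjacent ?F)\<^sup>*"
    by (simp add: rtrancl_subset_rtrancl)
  moreover have "simple_graph X ?F"
    using assms(1) by (auto simp: simple_graph_def)
  ultimately show ?thesis
    using assms(1,2) graph_connected_iff_reachable by blast
qed

text \<open>
  The cycle is given as a path \<open>p\<close> from \<open>v\<close> to \<open>w\<close> closed up by the edge \<open>{v, w}\<close>; the deleted
  edge is bypassed by running around the rest of the cycle.
\<close>

lemma connected_delete_cycle_edge:
  assumes "simple_graph X E" "graph_connected X E"
    and "graph_path X E v p w" "{v, w} \<in> E" "e \<in> path_edges p" "e \<noteq> {v, w}"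
  shows "graph_connected X (E - {e})"
proof -
  obtain a b where ab: "e = {a, b}" "(v, a) \<in> (adjacent (E - {e}))\<^sup>*"
    "(b, w) \<in> (adjacent (E - {e}))\<^sup>*"
    using path_edge_split[OF assms(3,5)] by blast
  have "(v, w) \<in> (adjacent (E - {e}))\<^sup>*"
    using assms(4,6) by (auto simp: adjacent_def)
  then have "(a, b) \<in> (adjacent (E - {e}))\<^sup>*"
    using ab(2,3) by (meson reachable_sym rtrancl_trans)
  then show ?thesis
    using connected_delete_edge[OF assms(1,2)] ab(1) by blast
qed

text \<open>
  As long as there is a cycle, one of its edges can be deleted. A finite graph runs out of cycles
  in this way, and what is left is a tree.
\<close>

lemma connected_contains_spanning_tree:
  assumes "finite E" "simple_graph X E" "graph_connected X E"
  shows "\<exists>T\<subseteq>E. tree_on X T"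
  using assms
proof (induction rule: finite_psubset_induct)
  case (psubset E)
  show ?case
  proof (cases "graph_acyclic X E")
    case True
    then show ?thesis
      using psubset.prems by (auto simp: tree_on_def)
  next
    case False
    then obtain v p w where p: "graph_path X E v p w" "3 \<le> length p" "{w, v} \<in> E"
      by (auto simp: graph_acyclic_def)
    \<comment> \<open>With a third vertex on the path, its first edge is not the closing edge of the cycle.\<close>
    from p(1,2) obtain y z q where pv: "p = v # y # z # q"
      by (auto simp: numeral_3_eq_3 Suc_le_length_iff graph_path_def)
    let ?e = "{v, y}"
    have e: "?e \<in> path_edges p" "?e \<noteq> {v, w}"
      using p(1) pv by (auto simp: path_edges_Cons_Cons graph_path_def doubleton_eq_iff split: if_splits)
    have "graph_connected X (E - {?e})"
      using connected_delete_cycle_edge[OF psubset.prems p(1) _ e] p(3) by (simp add: insert_commute)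
    moreover have "simple_graph X (E - {?e})"
      using psubset.prems(1) by (auto simp: simple_graph_def)
    moreover have "E - {?e} \<subset> E"
      using path_edges_subset[OF p(1)] e(1) by blast
    ultimately have "\<exists>T\<subseteq>E - {?e}. tree_on X T"
      by (intro psubset.IH)
    then show ?thesis
      by (meson Diff_subset subset_trans)
  qed
qed

section \<open>Edge lengths along paths\<close>

lemma finite_edges: "simple_graph X E \<Longrightarrow> finite X \<Longrightarrow> finite E"
  by (rule finite_subset[of _ "Pow X"]) (auto simp: simple_graph_def)

lemma (in Metric_space) edge_length_nonneg: "simple_graph X E \<Longrightarrow> e \<in> E \<Longrightarrow> 0 \<le> edge_length d e"
  by (auto simp: simple_graph_def edge_length_eq)

lemma (in Metric_space) minimal_spanning_tree_le_connected:
  assumes "minimal_spanning_tree X d E" "finite X" "simple_graph X F" "graph_connected X F"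
  shows "graph_length d E \<le> graph_length d F"
proof -
  have F: "finite F"
    using finite_edges assms by blast
  then obtain T where T: "T \<subseteq> F" "tree_on X T"
    using connected_contains_spanning_tree assms by blast
  then have "graph_length d E \<le> graph_length d T"
    using assms(1) by (simp add: minimal_spanning_tree_def)
  also have "\<dots> \<le> graph_length d F"
    unfolding graph_length_def using F T(1) edge_length_nonneg[OF assms(3)]
    by (intro sum_mono2) auto
  finally show ?thesis .
qed

text \<open>
  The exchange argument: replacing \<open>e\<close> by \<open>{v, w}\<close> leaves a connected graph, whose length exceeds
  that of the minimal tree by at most \<open>d v w\<close> minus the length of \<open>e\<close>.
\<close>

lemma (in Metric_space) minimal_spanning_tree_path_edge_le:
  assumes "minimal_spanning_tree X d E" "finite X"
    and "graph_path X E v p w" "e \<in> path_edges p" "v \<in> X" "w \<in> X" "v \<noteq> w"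
  shows "edge_length d e \<le> d v w"
proof (cases "e = {v, w}")
  case True
  then show ?thesis
    by (simp add: edge_length_eq)
next
  case False
  have tree: "simple_graph X E" "graph_connected X E"
    using assms(1) by (auto simp: minimal_spanning_tree_def tree_on_def)
  let ?F = "insert {v, w} E"
  have F: "simple_graph X ?F"
    using tree(1) assms(5-7) unfolding simple_graph_def by blast
  have "graph_connected X ?F"
    using tree(2) unfolding graph_connected_def by (meson graph_path_mono subset_insertI)
  then have "graph_connected X (?F - {e})"
    by (rule connected_delete_cycle_edge[OF F _ graph_path_mono[OF assms(3)] _ assms(4) False]) auto
  moreover have "simple_graph X (?F - {e})"
    using F by (auto simp: simple_graph_def)
  ultimately have "graph_length d E \<le> graph_length d (?F - {e})"
    using minimal_spanning_tree_le_connected assms(1,2) by blast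
  also have "\<dots> = graph_length d ?F - edge_length d e"
    using finite_edges[OF F assms(2)] path_edges_subset[OF assms(3)] assms(4)
    by (subst graph_length_def, subst sum_diff1) (auto simp: graph_length_def)
  also have "graph_length d ?F \<le> graph_length d E + d v w"
    using finite_edges[OF tree(1) assms(2)]
    by (cases "{v, w} \<in> E") (auto simp: graph_length_def insert_absorb edge_length_eq)
  finally show ?thesis
    by simp
qed

lemma (in Metric_space) ultrametric_le_path_edge:
  assumes "ultrametric_on X d" "set p \<subseteq> X" "p \<noteq> []" "hd p \<noteq> last p"
  shows "\<exists>e\<in>path_edges p. d (hd p) (last p) \<le> edge_length d e"
  using assms(2-4)
proof (induction p rule: induct_list012)
  case (3 x y q)
  let ?w = "last (y # q)"
  have "x \<in> X" "y \<in> X" "?w \<in> X"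
    using "3.prems"(1) last_in_set[of "y # q"] by (simp_all add: subset_iff)
  then have "d x ?w \<le> max (d x y) (d y ?w)"
    using assms(1) unfolding ultrametric_on_def by blast
  then have "d x ?w \<le> d x y \<or> d x ?w \<le> d y ?w"
    by (simp only: le_max_iff_disj)
  moreover have "d x ?w \<le> d x y" if "y = ?w"
    using arg_cong[OF that, of "d x"] by simp
  ultimately consider "d x ?w \<le> d x y" | "y \<noteq> ?w" "d x ?w \<le> d y ?w"
    by blast
  then show ?case
  proof cases
    case 1
    then show ?thesis
      by (simp add: path_edges_Cons_Cons edge_length_eq)
  next
    case 2
    then obtain e where "e \<in> path_edges (y # q)" "d y ?w \<le> edge_length d e"
      using "3.IH"(2) "3.prems"(1) by auto
    then show ?thesis
      using 2 by (intro bexI[of _ e]) (auto simp: path_edges_Cons_Cons)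
  qed
qed auto

theorem theorem3p1:
  fixes X :: "'a set" and d :: "'a \<Rightarrow> 'a \<Rightarrow> real" and E :: "'a set set"
  assumes "Metric_space X d" and "finite X"
    and "minimal_spanning_tree X d E"
  shows "ultrametric_on X d \<longleftrightarrow>
    (\<forall>v\<in>X. \<forall>w\<in>X. v \<noteq> w \<longrightarrow>
       d v w = Max (edge_length d ` path_edges (tree_path X E v w)))"
proof -
  interpret Metric_space X d
    by fact
  let ?P = "\<lambda>v w. path_edges (tree_path X E v w)"
  have tree: "tree_on X E"
    using assms(3) by (simp add: minimal_spanning_tree_def)
  note path = tree_path_is_path[OF tree]
  show ?thesis
  proof (intro iffI ballI impI)
    fix v w assume ultra: "ultrametric_on X d" and vw: "v \<in> X" "w \<in> X" "v \<noteq> w"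
    note p = path[OF vw(1,2)]
    obtain e where e: "e \<in> ?P v w" "d v w \<le> edge_length d e"
      using ultrametric_le_path_edge[OF ultra] p vw(3) unfolding graph_path_def by metis
    have le: "edge_length d e' \<le> d v w" if "e' \<in> ?P v w" for e'
      using minimal_spanning_tree_path_edge_le[OF assms(3,2) p that vw] .
    show "d v w = Max (edge_length d ` ?P v w)"
    proof (rule Max_eqI[symmetric])
      show "d v w \<in> edge_length d ` ?P v w"
        using e le[OF e(1)] by (intro image_eqI[of _ _ e]) auto
    qed (auto simp: finite_path_edges le)
  next
    assume eq: "\<forall>v\<in>X. \<forall>w\<in>X. v \<noteq> w \<longrightarrow> d v w = Max (edge_length d ` ?P v w)"
    have edge_le: "edge_length d e \<le> d v w" if "v \<in> X" "w \<in> X" "v \<noteq> w" "e \<in> ?P v w" for v w e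
      using eq that by (simp add: finite_path_edges)
    show "ultrametric_on X d"
      unfolding ultrametric_on_def
    proof (intro ballI)
      fix x y z assume xyz: "x \<in> X" "y \<in> X" "z \<in> X"
      show "d x z \<le> max (d x y) (d y z)"
      proof (cases "x = y \<or> y = z \<or> x = z")
        case True
        then show ?thesis
          using xyz by (auto simp: le_max_iff_disj)
      next
        case False
        have "Max (edge_length d ` ?P x z) \<in> edge_length d ` ?P x z"
          using path_edges_nonempty[OF path] xyz False by (intro Max_in) (auto simp: finite_path_edges)
        then obtain e where e: "e \<in> ?P x z" "d x z = edge_length d e"
          using eq xyz False by auto
        then have "e \<in> ?P x y \<union> ?P y z"
          using acyclic_path_edges_triangle[OF _ _ path[OF xyz(1,3)] path[OF xyz(1,2)] path[OF xyz(2,3)]]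
            tree unfolding tree_on_def by blast
        then show ?thesis
          using edge_le xyz False e(2) by (auto simp: le_max_iff_disj)
      qed
    qed
  qed
qed

end
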